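(* Let $X$ be a hermetic metric space and let $G$ be an open subset of $X$ all of whose points are non-isolated points of $X$. Then there exists a continuous function $f\colon X\to\mathbb{R}$ such that $L^\infty(f)=\ell^\infty(f)=G$ and $\mathbb{L}^\infty(f)=\overline{G}$.
   Context: The metric on $X$ is denoted $|\cdot-\cdot|_X$ and $B(x,r)=\{u\in X:|u-x|_X<r\}$. $X^d$ is the set of non-isolated points of $X$; $\overline{G}$ is the closure of $G$ in $X$. Hermeticity: for $x\in X$ put $H(X,x)=\liminf_{r\to0^+}\frac1r\sup_{u\in B(x,r)}|u-x|_X$, and $H(X)=\inf_{x\in X^d}H(X,x)$ (infimum in $[0,+\infty]$, so that $\inf\varnothing=+\infty$). The space $X$ is hermetic if $H(X)>0$. For $f\colon X\to\mathbb{R}$ and $x\in X$, with values in $[0,+\infty]$ and the convention $\sup\varnothing=0$ (so that all three quantities are $0$ at isolated points of $X$): - $\operatorname{\mathbb{L}ip} f(x)=\limsup_{(u,v)\to(x,x),\,u\ne v}\frac{|f(u)-f(v)|}{|u-v|_X}=\inf_{r>0}\sup_{u\neq v\in B(x,r)}\frac{|f(u)-f(v)|}{|u-v|_X}$ (local Lipschitz derivative); - $\operatorname{Lip} f(x)=\limsup_{u\to x,\,u\ne x}\frac{|f(u)-f(x)|}{|u-x|_X}$ (big Lipschitz derivative); - $\operatorname{lip} f(x)=\liminf_{r\to0^+}\sup_{u\in B(x,r)}\frac1r|f(u)-f(x)|$ (little Lipschitz derivative). $\mathbb{L}^\infty(f)=\{x:\operatorname{\mathbb{L}ip} f(x)=\infty\}$,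 $L^\infty(f)=\{x:\operatorname{Lip} f(x)=\infty\}$, $\ell^\infty(f)=\{x:\operatorname{lip} f(x)=\infty\}$. *)

theory Defs
  imports "HOL-Analysis.Analysis"
begin

text \<open>
  The metric space \<open>X\<close> is a type of class \<^class>\<open>metric_space\<close>. All suprema and limits are taken
  in \<^typ>\<open>ennreal\<close> \<open>= [0, \<infinity>]\<close>, where the supremum of the empty set is \<open>0\<close> and its infimum is \<open>\<infinity>\<close>.
\<close>

definition nonisolated_points :: "'a::metric_space set" where
  "nonisolated_points = {x. x islimpt UNIV}"

definition hermeticity_at :: "'a::metric_space \<Rightarrow> ennreal" where
  "hermeticity_at x =
     Liminf (at_right (0::real)) (\<lambda>r. ennreal (1 / r) * (SUP u\<in>ball x r. ennreal (dist u x)))"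

definition hermeticity :: "'a::metric_space itself \<Rightarrow> ennreal" where
  "hermeticity _ = (INF x\<in>(nonisolated_points :: 'a set). hermeticity_at x)"

definition hermetic :: "'a::metric_space itself \<Rightarrow> bool" where
  "hermetic X \<longleftrightarrow> hermeticity X > 0"

definition local_Lip :: "('a::metric_space \<Rightarrow> real) \<Rightarrow> 'a \<Rightarrow> ennreal" where
  "local_Lip f x =
     Limsup (at (x, x) within {(u, v). u \<noteq> v}) (\<lambda>(u, v). ennreal (\<bar>f u - f v\<bar> / dist u v))"

definition big_Lip :: "('a::metric_space \<Rightarrow> real) \<Rightarrow> 'a \<Rightarrow> ennreal" where
  "big_Lip f x = Limsup (at x) (\<lambda>u. ennreal (\<bar>f u - f x\<bar> / dist u x))"

definition little_lip :: "('a::metric_space \<Rightarrow> real) \<Rightarrow> 'a \<Rightarrow> ennreal" where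
  "little_lip f x =
     Liminf (at_right (0::real)) (\<lambda>r. SUP u\<in>ball x r. ennreal (1 / r * \<bar>f u - f x\<bar>))"

definition local_Lip_infinity_set :: "('a::metric_space \<Rightarrow> real) \<Rightarrow> 'a set" where
  "local_Lip_infinity_set f = {x. local_Lip f x = \<infinity>}"

definition big_Lip_infinity_set :: "('a::metric_space \<Rightarrow> real) \<Rightarrow> 'a set" where
  "big_Lip_infinity_set f = {x. big_Lip f x = \<infinity>}"

definition little_lip_infinity_set :: "('a::metric_space \<Rightarrow> real) \<Rightarrow> 'a set" where
  "little_lip_infinity_set f = {x. little_lip f x = \<infinity>}"

lemma local_Lip_eq_INF_SUP:
  "local_Lip f x =
     (INF r\<in>{0<..}. SUP (u, v)\<in>{(u, v). u \<in> ball x r \<and> v \<in> ball x r \<and> u \<noteq> v}.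
        ennreal (\<bar>f u - f v\<bar> / dist u v))"
    (is "_ = (INF r\<in>_. Sup (?q ` ?S r))")
proof (rule antisym)
  let ?F = "at (x, x) within {(u, v). u \<noteq> v}"
  show "local_Lip f x \<le> (INF r\<in>{0<..}. Sup (?q ` ?S r))"
  proof (rule INF_greatest)
    fix r :: real assume "r \<in> {0<..}"
    then have "eventually (\<lambda>p. p \<in> ?S r) ?F"
      unfolding eventually_at_topological
      by (intro exI[of _ "ball x r \<times> ball x r"]) (auto simp: open_Times)
    then have "eventually (\<lambda>p. ?q p \<le> Sup (?q ` ?S r)) ?F"
      by (rule eventually_mono) (rule SUP_upper)
    then show "local_Lip f x \<le> Sup (?q ` ?S r)"
      unfolding local_Lip_def by (rule Limsup_bounded)
  qed
  show "(INF r\<in>{0<..}. Sup (?q ` ?S r)) \<le> local_Lip f x"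
    unfolding local_Lip_def Limsup_def
  proof (rule INF_greatest)
    fix P assume "P \<in> {P. eventually P ?F}"
    then obtain W where W: "open W" "(x, x) \<in> W" "\<And>p. p \<in> W \<Longrightarrow> p \<noteq> (x, x) \<Longrightarrow> fst p \<noteq> snd p \<Longrightarrow> P p"
      by (simp add: eventually_at_topological case_prod_beta) (metis)
    obtain A B where AB: "open A" "open B" "x \<in> A" "x \<in> B" "A \<times> B \<subseteq> W"
      using open_prod_elim[OF W(1,2)] by (metis mem_Sigma_iff)
    have "open (A \<inter> B)" "x \<in> A \<inter> B"
      using AB by auto
    then obtain r where r: "r > 0" "ball x r \<subseteq> A \<inter> B"
      by (rule openE)
    have "?S r \<subseteq> {p. P p}"
    proof (rule subsetI)
      fix p assume p: "p \<in> ?S r"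
      then have "fst p \<in> ball x r" "snd p \<in> ball x r" and ne: "fst p \<noteq> snd p"
        by (simp_all add: case_prod_beta)
      then have "fst p \<in> A" "snd p \<in> B"
        using r(2) by blast+
      then have "p \<in> W"
        using AB(5) by (metis mem_Times_iff subsetD)
      moreover have "p \<noteq> (x, x)"
        using ne by (metis fst_conv snd_conv)
      ultimately show "p \<in> {p. P p}"
        using W(3) ne by (simp only: mem_Collect_eq)
    qed
    then have "Sup (?q ` ?S r) \<le> Sup (?q ` {p. P p})"
      by (intro SUP_subset_mono) auto
    then show "(INF r\<in>{0<..}. Sup (?q ` ?S r)) \<le> Sup (?q ` {p. P p})"
      using r(1) by (intro INF_lower2[of r]) auto
  qed
qed

end

theory Submission imports Defs begin

text \<open>
  Let \<open>S\<^sub>n\<close> be a maximal \<open>\<delta>\<^sup>2\<^sup>n\<close>-separated set and \<open>\<phi>\<^sub>n\<close> the distance to \<open>S\<^sub>n\<close> in units of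
  \<open>\<delta>\<^sup>2\<^sup>n\<close>, cut off at \<open>1\<close>. Every point is close to a zero of \<open>\<phi>\<^sub>n\<close>, and hermeticity provides a point at
  distance comparable to \<open>\<delta>\<^sup>2\<^sup>n\<close> from any given zero; so \<open>\<phi>\<^sub>n\<close> oscillates by a fixed amount around
  each non-isolated point as soon as \<open>n\<close> is large. For small \<open>\<delta>\<close> the Weierstrass type series
  \<open>F = \<Sum>\<^sub>n \<delta>\<^sup>n \<phi>\<^sub>n\<close> inherits at scale \<open>\<delta>\<^sup>2\<^sup>n\<close> an oscillation of order \<open>\<delta>\<^sup>n\<close>, hence has infinite
  little Lipschitz derivative at all non-isolated points. Multiplying the bounded function \<open>F\<close> by
  the distance to the complement of \<open>G\<close> keeps this property on \<open>G\<close> and makes the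
  big Lipschitz derivative finite elsewhere.
\<close>

section \<open>Hermeticity in terms of real inequalities\<close>

lemma ennreal_eq_infinityI:
  assumes "\<And>K::real. K > 0 \<Longrightarrow> ennreal K \<le> z"
  shows "z = \<infinity>"
proof (cases z)
  case (real r)
  have "ennreal (r + 1) \<le> ennreal r"
    using assms[of "r + 1"] real by simp
  then show ?thesis
    using real(1) by (subst (asm) ennreal_le_iff) auto
qed simp

text \<open>Any \<open>c\<close> strictly below the hermeticity lies below every liminf, so one
  \<open>c\<close> serves all non-isolated points. Only the threshold on \<open>r\<close> varies
  with the point, which is harmless because steepness is an asymptotic condition at each point
  separately.\<close>

lemma hermetic_imp_annulus_points:
  assumes "hermetic TYPE('a::metric_space)"
  obtains c where "0 < c" "c \<le> 1"
    "\<forall>x\<in>nonisolated_points :: 'a set.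
      eventually (\<lambda>r. \<exists>u\<in>ball x r. c * r < dist u x) (at_right 0)"
proof -
  let ?H = "hermeticity TYPE('a)"
  \<comment> \<open>The cap at \<open>1\<close> keeps \<open>e\<close> finite even if the
    hermeticity is infinite, and gives \<open>c \<le> 1\<close>.\<close>
  have "0 < min ?H 1"
    using assms by (simp add: hermetic_def)
  then obtain e where e: "0 < e" "e < min ?H 1"
    using dense by blast
  then have "e < top"
    by (metis ennreal_one_less_top min_less_iff_conj order.strict_trans)
  then obtain c where c: "e = ennreal c" "0 \<le> c"
    by (cases e) auto
  have c01: "0 < c" "c \<le> 1"
    using e c by (auto simp flip: ennreal_1 simp: ennreal_less_iff)
  show thesis
  proof (rule that[OF c01], rule ballI)
    fix x :: 'a assume x: "x \<in> nonisolated_points"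
    have "ennreal c < hermeticity_at x"
      using e x unfolding c hermeticity_def by (auto intro: less_le_trans INF_lower)
    then have "eventually (\<lambda>r. ennreal c < ennreal (1 / r) * (SUP u\<in>ball x r. ennreal (dist u x)))
        (at_right 0)"
      unfolding hermeticity_at_def by (rule less_LiminfD)
    moreover have "eventually (\<lambda>r::real. r > 0) (at_right 0)"
      by (rule eventually_at_right_less)
    ultimately show "eventually (\<lambda>r. \<exists>u\<in>ball x r. c * r < dist u x) (at_right 0)"
    proof eventually_elim
      case (elim r)
      then obtain u where u: "u \<in> ball x r" "ennreal c < ennreal (1 / r) * ennreal (dist u x)"
        by (auto simp: SUP_mult_left_ennreal less_SUP_iff)
      then have "c < 1 / r * dist u x"
        using elim c by (simp flip: ennreal_mult add: ennreal_less_iff)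
      then show ?case
        using u elim by (auto simp: field_simps)
    qed
  qed
qed

section \<open>Separated nets, oscillation at one scale, lacunary sums\<close>

text \<open>Zorn's lemma: a point at distance at least \<open>e\<close> from all of a maximal
  separated set could be added to it.\<close>

lemma exists_maximal_separated_set:
  fixes e :: real
  assumes "e > 0"
  obtains S :: "'a::metric_space set"
    where "\<And>s t. s \<in> S \<Longrightarrow> t \<in> S \<Longrightarrow> s \<noteq> t \<Longrightarrow> e \<le> dist s t"
      and "\<And>x. \<exists>s\<in>S. dist x s < e"
proof -
  define A where "A = {S :: 'a set. \<forall>s\<in>S. \<forall>t\<in>S. s \<noteq> t \<longrightarrow> e \<le> dist s t}"
  have "\<exists>M\<in>A. \<forall>X\<in>A. M \<subseteq> X \<longrightarrow> X = M"
  proof (rule subset_Zorn')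
    fix C assume "subset.chain A C"
    then have C: "C \<subseteq> A" "\<And>X Y. X \<in> C \<Longrightarrow> Y \<in> C \<Longrightarrow> X \<subseteq> Y \<or> Y \<subseteq> X"
      by (auto simp: subset_chain_def)
    show "\<Union>C \<in> A"
      unfolding A_def
    proof safe
      fix s t X Y assume "s \<in> X" "X \<in> C" "t \<in> Y" "Y \<in> C" "s \<noteq> t"
      with C(2)[of X Y] C(1)[unfolded A_def] show "e \<le> dist s t"
        by blast
    qed
  qed
  then obtain S where S: "S \<in> A" and max: "\<And>X. X \<in> A \<Longrightarrow> S \<subseteq> X \<Longrightarrow> X = S"
    by blast
  have "\<exists>s\<in>S. dist x s < e" for x
  proof (rule ccontr)
    assume "\<not> (\<exists>s\<in>S. dist x s < e)"
    then have far: "e \<le> dist x s" "e \<le> dist s x" if "s \<in> S" for s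
      using that by (auto simp: not_less dist_commute)
    then have "insert x S \<in> A"
      using S by (auto simp: A_def)
    then have "x \<in> S"
      using max[of "insert x S"] by blast
    then show False
      using far[of x] assms by simp
  qed
  then show thesis
    using that[of S] S unfolding A_def by blast
qed

text \<open>If \<open>\<phi> x\<close> is at least \<open>c / 12\<close>, a net point within
  \<open>e\<close> of \<open>x\<close> is a zero of \<open>\<phi>\<close> and serves as
  \<open>u\<close>. Otherwise \<open>x\<close> nearly coincides with a net point, and the point
  supplied by the annulus condition is far from the whole net.\<close>

lemma oscillating_function_at_scale:
  fixes e c :: real
  assumes e: "e > 0" and c: "0 < c" "c \<le> 1"
  obtains \<phi> :: "'a::metric_space \<Rightarrow> real"
    where "\<And>x. 0 \<le> \<phi> x" "\<And>x. \<phi> x \<le> 1" "\<And>x y. \<bar>\<phi> x - \<phi> y\<bar> \<le> dist x y / e"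
      and "\<And>x. \<exists>u\<in>ball x (e / 4). c * (e / 4) < dist u x \<Longrightarrow>
        \<exists>u\<in>ball x e. c / 12 \<le> \<bar>\<phi> u - \<phi> x\<bar>"
proof -
  obtain S :: "'a set" where sep: "\<And>s t. s \<in> S \<Longrightarrow> t \<in> S \<Longrightarrow> s \<noteq> t \<Longrightarrow> e \<le> dist s t"
    and net: "\<And>x. \<exists>s\<in>S. dist x s < e"
    using exists_maximal_separated_set[OF e] by metis
  have ne: "S \<noteq> {}"
    using net by blast
  define \<phi> where "\<phi> x = min 1 (infdist x S / e)" for x
  show thesis
  proof (rule that[of \<phi>])
    show "0 \<le> \<phi> x" "\<phi> x \<le> 1" for x
      using e by (auto simp: \<phi>_def infdist_nonneg)
    show "\<bar>\<phi> x - \<phi> y\<bar> \<le> dist x y / e" for x y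
    proof -
      have "\<bar>\<phi> x - \<phi> y\<bar> \<le> \<bar>infdist x S / e - infdist y S / e\<bar>"
        unfolding \<phi>_def by linarith
      also have "\<dots> = \<bar>infdist x S - infdist y S\<bar> / e"
        using e by (simp flip: diff_divide_distrib)
      also have "\<dots> \<le> dist x y / e"
        using e by (intro divide_right_mono) (auto intro: infdist_triangle_abs)
      finally show ?thesis .
    qed
    fix x :: 'a assume "\<exists>u\<in>ball x (e / 4). c * (e / 4) < dist u x"
    then obtain u where u: "dist u x < e / 4" "c * (e / 4) < dist u x"
      by (auto simp: dist_commute)
    show "\<exists>u\<in>ball x e. c / 12 \<le> \<bar>\<phi> u - \<phi> x\<bar>"
    proof (cases "c / 12 \<le> \<phi> x")
      case True
      obtain s where "s \<in> S" "dist x s < e"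
        using net by blast
      then show ?thesis
        using True by (intro bexI[of _ s]) (auto simp: \<phi>_def)
    next
      case False
      then have "infdist x S / e < c / 12"
        using c by (auto simp: \<phi>_def min_def split: if_splits)
      then have "infdist x S < c / 12 * e"
        using e by (simp add: field_simps)
      then obtain s where s: "s \<in> S" "dist x s < c / 12 * e"
        unfolding infdist_notempty[OF ne] cINF_less_iff[OF ne bdd_below_image_dist] by blast
      have ce: "c * e \<le> e"
        using c e by simp
      \<comment> \<open>The net point \<open>s\<close> close to \<open>x\<close> stays more than
        \<open>c/4 - c/12 = c/6\<close> units of \<open>e\<close> away from \<open>u\<close>. Any
        other net point is at least \<open>e\<close> from \<open>s\<close>, while \<open>u\<close>
        is within \<open>e/12 + e/4\<close> of \<open>s\<close>; this is why the annulus is taken at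
        radius \<open>e / 4\<close>.\<close>
      have "c / 6 * e \<le> dist u t" if t: "t \<in> S" for t
      proof (cases "t = s")
        case True
        then show ?thesis
          using dist_triangle[of u x s] s u by (simp add: dist_commute)
      next
        case False
        have "e \<le> dist s t"
          using sep s t False by metis
        also have "\<dots> \<le> dist s x + dist x u + dist u t"
          using dist_triangle[of s t x] dist_triangle[of x t u] by linarith
        finally show ?thesis
          using e s u ce dist_commute[of s x] dist_commute[of x u] by linarith
      qed
      then have "c / 6 * e \<le> infdist u S"
        unfolding infdist_notempty[OF ne] by (rule cINF_greatest[OF ne])
      then have "c / 6 \<le> infdist u S / e"
        using e by (simp add: field_simps)
      then have "c / 6 \<le> \<phi> u"
        using c by (simp add: \<phi>_def)
      then have "c / 12 \<le> \<bar>\<phi> u - \<phi> x\<bar>"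
        using False by linarith
      then show ?thesis
        using u e by (intro bexI[of _ u]) (auto simp: dist_commute)
    qed
  qed
qed

text \<open>The factor \<open>4 \<delta>\<close> beats both the Lipschitz part of the series and its tail.\<close>

lemma lacunary_series_increment:
  fixes a b :: "nat \<Rightarrow> real"
  assumes \<delta>: "0 < \<delta>" "\<delta> \<le> 1/4"
    and ab: "\<And>i. 0 \<le> a i" "\<And>i. a i \<le> 1" "\<And>i. 0 \<le> b i" "\<And>i. b i \<le> 1"
    and low: "\<And>i. i < n \<Longrightarrow> \<bar>a i - b i\<bar> \<le> (\<delta>^2)^n / (\<delta>^2)^i"
    and mid: "4 * \<delta> \<le> \<bar>a n - b n\<bar>"
  shows "\<delta> ^ Suc n \<le> \<bar>(\<Sum>i. \<delta>^i * a i) - (\<Sum>i. \<delta>^i * b i)\<bar>"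
proof -
  define d where "d i = a i - b i" for i
  have d1: "\<bar>d i\<bar> \<le> 1" for i
    using ab[of i] by (auto simp: d_def)
  have geo: "summable (\<lambda>i. \<delta>^i)"
    using \<delta> by (intro summable_geometric) auto
  have sa: "summable (\<lambda>i. \<delta>^i * a i)"
    using \<delta> ab by (intro summable_comparison_test'[OF geo, of 0]) (auto simp: abs_mult mult_left_le)
  have sb: "summable (\<lambda>i. \<delta>^i * b i)"
    using \<delta> ab by (intro summable_comparison_test'[OF geo, of 0]) (auto simp: abs_mult mult_left_le)
  have sd: "summable (\<lambda>i. \<delta>^i * d i)"
    using summable_diff[OF sa sb] by (simp add: d_def algebra_simps)
  have eq: "(\<Sum>i. \<delta>^i * a i) - (\<Sum>i. \<delta>^i * b i) = (\<Sum>i. \<delta>^i * d i)"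
    using suminf_diff[OF sa sb] by (simp add: d_def algebra_simps)
  have split: "(\<Sum>i. \<delta>^i * d i) = (\<Sum>i. \<delta>^(i + Suc n) * d (i + Suc n)) + (\<Sum>i<n. \<delta>^i * d i) + \<delta>^n * d n"
    using suminf_split_initial_segment[OF sd, of "Suc n"] by simp
  \<comment> \<open>The Lipschitz bounds grow geometrically in \<open>i\<close>, so the last term
    \<open>i = n - 1\<close>, of size \<open>\<delta> ^ Suc n\<close>, dominates. The head thus gets
    the same bound as the tail.\<close>
  have "\<bar>\<Sum>i<n. \<delta>^i * d i\<bar> \<le> (\<Sum>i<n. \<delta>^(2*n) * (1/\<delta>)^i)"
  proof (rule order_trans[OF sum_abs sum_mono])
    fix i assume "i \<in> {..<n}"
    then have "\<bar>d i\<bar> \<le> (\<delta>^2)^n / (\<delta>^2)^i"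
      using low by (simp add: d_def)
    then have "\<delta>^i * \<bar>d i\<bar> \<le> \<delta>^i * ((\<delta>^2)^n / (\<delta>^2)^i)"
      using \<delta> by (intro mult_left_mono) auto
    also have "\<dots> = \<delta>^(2*n) * (1/\<delta>)^i"
      using \<delta> by (simp add: power_mult field_simps power2_eq_square power_mult_distrib)
    finally show "\<bar>\<delta>^i * d i\<bar> \<le> \<delta>^(2*n) * (1/\<delta>)^i"
      using \<delta> by (simp add: abs_mult)
  qed
  also have "\<dots> = \<delta>^(2*n) * (((1/\<delta>)^n - 1) / (1/\<delta> - 1))"
    using \<delta> by (simp add: geometric_sum flip: sum_distrib_left)
  also have "\<dots> \<le> \<delta>^(2*n) * ((1/\<delta>)^n / (1/\<delta> - 1))"
    using \<delta> by (intro mult_left_mono divide_right_mono) auto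
  also have "\<dots> = \<delta>^n * (\<delta> / (1 - \<delta>))"
    using \<delta> by (simp add: field_simps power_mult power2_eq_square power_mult_distrib)
  finally have head: "\<bar>\<Sum>i<n. \<delta>^i * d i\<bar> \<le> \<delta>^n * (\<delta> / (1 - \<delta>))" .
  have geo': "(\<lambda>i. \<delta>^(i + Suc n)) sums (\<delta>^n * (\<delta> / (1 - \<delta>)))"
    using sums_mult[OF geometric_sums[of \<delta>], of "\<delta>^Suc n"] \<delta> by (simp add: power_add mult_ac)
  have "\<bar>\<Sum>i. \<delta>^(i + Suc n) * d (i + Suc n)\<bar> \<le> (\<Sum>i. \<delta>^(i + Suc n))"
  proof -
    have "norm (\<Sum>i. \<delta>^(i + Suc n) * d (i + Suc n)) \<le> (\<Sum>i. \<delta>^(i + Suc n))"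
      using d1 \<delta> sums_summable[OF geo']
      by (intro norm_suminf_le) (auto simp del: power_Suc simp: abs_mult mult_left_le)
    then show ?thesis by simp
  qed
  then have tail: "\<bar>\<Sum>i. \<delta>^(i + Suc n) * d (i + Suc n)\<bar> \<le> \<delta>^n * (\<delta> / (1 - \<delta>))"
    using sums_unique[OF geo'] by simp
  \<comment> \<open>Head and tail together cost at most \<open>8/3 * \<delta>\<close> out of the
    \<open>4 * \<delta>\<close> in the middle term, so more than \<open>\<delta>\<close> remains,
    all in units of \<open>\<delta>^n\<close>.\<close>
  have "\<delta> / (1 - \<delta>) \<le> 4/3 * \<delta>"
    using \<delta> by (simp add: field_simps)
  then have small: "\<delta>^n * (\<delta> / (1 - \<delta>)) \<le> \<delta>^n * (4/3 * \<delta>)"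
    using \<delta> by (intro mult_left_mono) auto
  have "\<delta>^n * (4 * \<delta>) \<le> \<delta>^n * \<bar>d n\<bar>"
    using mid \<delta> by (intro mult_left_mono) (auto simp: d_def)
  then have "\<delta>^n * (4 * \<delta>) \<le> \<bar>\<delta>^n * d n\<bar>"
    using \<delta> by (simp add: abs_mult)
  moreover have "0 \<le> \<delta>^n * \<delta>"
    using \<delta> by simp
  ultimately show ?thesis
    unfolding eq split power_Suc2[of \<delta> n] using head tail small by linarith
qed

section \<open>Steep points and the steep series\<close>

text \<open>An infinite little Lipschitz derivative, unfolded into real inequalities so that
  estimates avoid \<open>ennreal\<close>.\<close>

definition steep_at :: "('a::metric_space \<Rightarrow> real) \<Rightarrow> 'a \<Rightarrow> bool" where
  "steep_at f x \<longleftrightarrow>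
    (\<forall>K>0. eventually (\<lambda>r. \<exists>u\<in>ball x r. K * r \<le> \<bar>f u - f x\<bar>) (at_right 0))"

text \<open>At scale \<open>(\<delta>^2)^n\<close> the ratio of oscillation to radius is of order
  \<open>\<delta>^n / (\<delta>^2)^n\<close>, which tends to infinity. A general \<open>r\<close>
  lies between consecutive scales, which costs only a constant factor.\<close>

lemma steep_at_geometric_scales:
  fixes \<delta> :: real
  assumes \<delta>: "0 < \<delta>" "\<delta> < 1"
    and osc: "eventually (\<lambda>n. \<exists>u\<in>ball x ((\<delta>^2)^n). \<delta> ^ Suc n \<le> \<bar>f u - f x\<bar>) sequentially"
  shows "steep_at f x"
  unfolding steep_at_def
proof (intro allI impI)
  fix K :: real assume K: "K > 0"
  have "(\<lambda>n. \<delta>^n) \<longlonglongrightarrow> 0"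
    using \<delta> by (intro LIMSEQ_realpow_zero) auto
  then have "eventually (\<lambda>n. \<delta>^n < \<delta>^2 / K) sequentially"
    using \<delta> K by (intro order_tendstoD(2)) auto
  then obtain N where N: "\<And>n. n \<ge> N \<Longrightarrow> \<exists>u\<in>ball x ((\<delta>^2)^n). \<delta> ^ Suc n \<le> \<bar>f u - f x\<bar>"
    "\<And>n. n \<ge> N \<Longrightarrow> \<delta>^n < \<delta>^2 / K"
    using osc unfolding eventually_sequentially by (metis linear order.trans)
  have \<theta>: "0 < \<delta>^2" "\<delta>^2 < 1"
    using \<delta> by (auto simp: power_less_one_iff)
  have "\<exists>u\<in>ball x r. K * r \<le> \<bar>f u - f x\<bar>" if r: "0 < r" "r < (\<delta>^2)^N" for r
  proof -
    let ?P = "\<lambda>n. (\<delta>^2)^n < r"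
    have ex: "\<exists>n. ?P n"
      using real_arch_pow_inv[OF r(1) \<theta>(2)] .
    \<comment> \<open>The first scale below \<open>r\<close>: its ball lies in
      \<open>ball x r\<close>, while \<open>r\<close> is at most the preceding scale. Moving from
      \<open>n\<close> to \<open>m = Suc n\<close> loses the factor \<open>\<delta>^2\<close> that
      was built into the threshold \<open>\<delta>^2 / K\<close>.\<close>
    define m where "m = (LEAST n. ?P n)"
    have Pm: "?P m"
      unfolding m_def using ex by (rule LeastI_ex)
    have "N < m"
    proof (rule ccontr)
      assume "\<not> N < m"
      then have "(\<delta>^2)^N \<le> (\<delta>^2)^m"
        using \<theta> by (intro power_decreasing) auto
      then show False using Pm r by simp
    qed
    then obtain n where n: "m = Suc n" "n \<ge> N"
      by (cases m) auto
    have "\<not> ?P n"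
      using not_less_Least[of n ?P] n unfolding m_def[symmetric] by simp
    then have rn: "r \<le> (\<delta>^2)^n" by simp
    obtain u where u: "u \<in> ball x ((\<delta>^2)^m)" "\<delta> ^ Suc m \<le> \<bar>f u - f x\<bar>"
      using N(1)[of m] \<open>N < m\<close> by auto
    have "K * r \<le> K * (\<delta>^n * \<delta>^n)"
      using K rn by (simp add: power2_eq_square power_mult_distrib)
    also have "\<dots> \<le> \<delta>^2 * \<delta>^n"
      using N(2)[OF n(2)] K \<delta> by (simp add: field_simps)
    also have "\<dots> = \<delta> ^ Suc m"
      using n by (simp add: power2_eq_square)
    finally show ?thesis
      using u Pm by (intro bexI[of _ u]) auto
  qed
  then show "eventually (\<lambda>r. \<exists>u\<in>ball x r. K * r \<le> \<bar>f u - f x\<bar>) (at_right 0)"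
    using \<theta> by (auto simp: eventually_at_right_field intro!: exI[of _ "(\<delta>^2)^N"])
qed

lemma hermetic_exists_steep_function:
  assumes "hermetic TYPE('a::metric_space)"
  obtains F :: "'a::metric_space \<Rightarrow> real"
    where "continuous_on UNIV F" "\<And>x. \<bar>F x\<bar> \<le> 2"
      and "\<And>x. x \<in> nonisolated_points \<Longrightarrow> steep_at F x"
proof -
  obtain c where c: "0 < c" "c \<le> 1"
    and ann: "\<forall>x\<in>nonisolated_points :: 'a set.
      eventually (\<lambda>r. \<exists>u\<in>ball x r. c * r < dist u x) (at_right 0)"
    using hermetic_imp_annulus_points[OF assms] .
  \<comment> \<open>Chosen so that \<open>4 * \<delta>\<close> equals the guaranteed oscillation
    \<open>c / 12\<close>.\<close>
  define \<delta> where "\<delta> = c / 48"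
  have \<delta>: "0 < \<delta>" "\<delta> \<le> 1/4" "\<delta> < 1"
    using c by (auto simp: \<delta>_def)
  have \<theta>: "0 < \<delta>^2" "\<delta>^2 < 1"
    using \<delta> by (auto simp: power_less_one_iff)
  have "\<exists>\<phi> :: 'a \<Rightarrow> real. (\<forall>x. 0 \<le> \<phi> x) \<and> (\<forall>x. \<phi> x \<le> 1) \<and>
      (\<forall>x y. \<bar>\<phi> x - \<phi> y\<bar> \<le> dist x y / (\<delta>^2)^n) \<and>
      (\<forall>x. (\<exists>u\<in>ball x ((\<delta>^2)^n / 4). c * ((\<delta>^2)^n / 4) < dist u x) \<longrightarrow>
        (\<exists>u\<in>ball x ((\<delta>^2)^n). c / 12 \<le> \<bar>\<phi> u - \<phi> x\<bar>))" for n
    by (rule oscillating_function_at_scale[of "(\<delta>^2)^n" c]) (use \<theta> c in auto)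
  then obtain \<phi> :: "nat \<Rightarrow> 'a \<Rightarrow> real"
    where \<phi>: "\<And>n x. 0 \<le> \<phi> n x" "\<And>n x. \<phi> n x \<le> 1"
      and lip: "\<And>n x y. \<bar>\<phi> n x - \<phi> n y\<bar> \<le> dist x y / (\<delta>^2)^n"
      and osc: "\<And>n x. \<exists>u\<in>ball x ((\<delta>^2)^n / 4). c * ((\<delta>^2)^n / 4) < dist u x \<Longrightarrow>
        \<exists>u\<in>ball x ((\<delta>^2)^n). c / 12 \<le> \<bar>\<phi> n u - \<phi> n x\<bar>"
    by metis
  define F where "F x = (\<Sum>i. \<delta>^i * \<phi> i x)" for x
  have geo: "summable (\<lambda>i. \<delta>^i)"
    using \<delta> by (intro summable_geometric) auto
  have bound: "norm (\<delta>^i * \<phi> i x) \<le> \<delta>^i" for i x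
    using \<phi> \<delta> by (auto simp: abs_mult mult_left_le)
  have cont: "continuous_on UNIV (\<phi> n)" for n
  proof (rule lipschitz_on_continuous_on)
    show "lipschitz_on (1 / (\<delta>^2)^n) UNIV (\<phi> n)"
      using \<theta> lip by (intro lipschitz_onI) (auto simp: dist_real_def)
  qed
  show thesis
  proof (rule that[of F])
    have "uniform_limit UNIV (\<lambda>n x. \<Sum>i<n. \<delta>^i * \<phi> i x) F sequentially"
      unfolding F_def using bound geo by (intro Weierstrass_m_test) auto
    then show "continuous_on UNIV F"
      using cont by (intro uniform_limit_theorem[of _ "\<lambda>n x. \<Sum>i<n. \<delta>^i * \<phi> i x" sequentially])
        (auto intro!: continuous_intros always_eventually)
    show "\<bar>F x\<bar> \<le> 2" for x
    proof -
      have "norm (F x) \<le> (\<Sum>i. \<delta>^i)"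
        unfolding F_def using bound geo by (intro norm_suminf_le) auto
      also have "\<dots> = 1 / (1 - \<delta>)"
        using \<delta> by (intro suminf_geometric) auto
      also have "\<dots> \<le> 2"
        using \<delta> by (simp add: field_simps)
      finally show ?thesis by simp
    qed
    fix x :: 'a assume x: "x \<in> nonisolated_points"
    \<comment> \<open>The radii \<open>(\<delta>^2)^n / 4\<close> at which the annulus condition is
      needed tend to \<open>0\<close> from the right, so it holds for all large
      \<open>n\<close>.\<close>
    have "filterlim (\<lambda>n. (\<delta>^2)^n / 4) (at_right 0) sequentially"
      unfolding filterlim_at
      using \<theta> tendsto_divide[OF LIMSEQ_realpow_zero[of "\<delta>^2"] tendsto_const[of 4]] by auto
    from eventually_compose_filterlim[OF bspec[OF ann x] this]
    have "eventually (\<lambda>n. \<exists>u\<in>ball x ((\<delta>^2)^n). \<delta> ^ Suc n \<le> \<bar>F u - F x\<bar>) sequentially"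
    proof eventually_elim
      case (elim n)
      then obtain u where u: "u \<in> ball x ((\<delta>^2)^n)" "c / 12 \<le> \<bar>\<phi> n u - \<phi> n x\<bar>"
        using osc by blast
      have "\<delta> ^ Suc n \<le> \<bar>F u - F x\<bar>"
        unfolding F_def
      proof (rule lacunary_series_increment)
        show "\<bar>\<phi> i u - \<phi> i x\<bar> \<le> (\<delta>^2)^n / (\<delta>^2)^i" for i
        proof (rule order_trans[OF lip])
          show "dist u x / (\<delta>^2)^i \<le> (\<delta>^2)^n / (\<delta>^2)^i"
            using u \<theta> by (intro divide_right_mono) (auto simp: dist_commute)
        qed
      qed (use \<delta> \<phi> u in \<open>auto simp: \<delta>_def\<close>)
      then show ?case using u by blast
    qed
    with \<delta> show "steep_at F x"
      by (intro steep_at_geometric_scales) auto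
  qed
qed

section \<open>Consequences of steepness for products and for the three derivatives\<close>

lemma steep_at_mult_Lipschitz:
  assumes F: "steep_at F x" "\<And>u. \<bar>F u\<bar> \<le> B"
    and \<rho>: "\<And>u. \<bar>\<rho> u - \<rho> x\<bar> \<le> dist u x" "\<rho> x > 0"
  shows "steep_at (\<lambda>u. \<rho> u * F u) x"
  unfolding steep_at_def
proof (intro allI impI)
  fix K :: real assume K: "K > 0"
  have B: "B \<ge> 0"
    using F(2)[of x] by linarith
  \<comment> \<open>Multiplying by \<open>\<rho> x\<close> turns this slope into
    \<open>K + B\<close>; the variation of \<open>\<rho>\<close> can take away at most
    \<open>B * r\<close>.\<close>
  have "eventually (\<lambda>r. \<exists>u\<in>ball x r. (K + B) / \<rho> x * r \<le> \<bar>F u - F x\<bar>) (at_right 0)"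
    using F(1) K B \<rho>(2) unfolding steep_at_def by (elim allE[of _ "(K + B) / \<rho> x"]) simp
  then show "eventually (\<lambda>r. \<exists>u\<in>ball x r. K * r \<le> \<bar>\<rho> u * F u - \<rho> x * F x\<bar>) (at_right 0)"
  proof eventually_elim
    case (elim r)
    then obtain u where u: "dist u x < r" "(K + B) / \<rho> x * r \<le> \<bar>F u - F x\<bar>"
      by (auto simp: dist_commute)
    have "(K + B) * r \<le> \<bar>\<rho> x * (F u - F x)\<bar>"
      unfolding abs_mult using u \<rho>(2) by (simp add: field_simps)
    moreover have "\<bar>(\<rho> u - \<rho> x) * F u\<bar> \<le> r * B"
      unfolding abs_mult using \<rho>(1)[of u] u(1) F(2) zero_le_dist[of u x]
      by (intro mult_mono) (linarith | simp)+
    moreover have "\<rho> u * F u - \<rho> x * F x = \<rho> x * (F u - F x) + (\<rho> u - \<rho> x) * F u"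
      by (simp add: algebra_simps)
    ultimately have "K * r \<le> \<bar>\<rho> u * F u - \<rho> x * F x\<bar>"
      by (simp add: algebra_simps)
    then show ?case
      using u by (intro bexI[of _ u]) (auto simp: dist_commute)
  qed
qed

text \<open>The positive increment \<open>K * r\<close> rules out \<open>u = x\<close>, and
  replacing \<open>r\<close> by the smaller \<open>dist u x\<close> only enlarges the
  quotient.\<close>

lemma steep_at_imp_secant:
  assumes "steep_at f x" "K > 0" "e > 0"
  obtains u where "u \<in> ball x e" "u \<noteq> x" "K \<le> \<bar>f u - f x\<bar> / dist u x"
proof -
  have "eventually (\<lambda>r. (\<exists>u\<in>ball x r. K * r \<le> \<bar>f u - f x\<bar>) \<and> 0 < r \<and> r < e) (at_right 0)"
    using assms by (intro eventually_conj)
      (auto simp: steep_at_def eventually_at_right_less eventually_at_right_field)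
  from eventually_happens'[OF trivial_limit_at_right_real this]
  obtain r u where r: "0 < r" "r < e" and u: "dist x u < r" "K * r \<le> \<bar>f u - f x\<bar>"
    by auto
  have "u \<noteq> x"
    using u mult_pos_pos[OF assms(2) r(1)] by auto
  moreover have "K * dist u x \<le> K * r"
    using u assms by (simp add: dist_commute)
  ultimately have "K \<le> \<bar>f u - f x\<bar> / dist u x"
    using u by (simp add: field_simps)
  then show thesis
    using that[of u] \<open>u \<noteq> x\<close> u r by auto
qed

lemma steep_at_imp_little_lip: "steep_at f x \<Longrightarrow> little_lip f x = \<infinity>"
proof (rule ennreal_eq_infinityI)
  fix K :: real assume f: "steep_at f x" and K: "K > 0"
  have "eventually (\<lambda>r. \<exists>u\<in>ball x r. K * r \<le> \<bar>f u - f x\<bar>) (at_right 0)"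
    using f K by (simp add: steep_at_def)
  then have "eventually (\<lambda>r. ennreal K \<le> (SUP u\<in>ball x r. ennreal (1 / r * \<bar>f u - f x\<bar>))) (at_right 0)"
    using eventually_at_right_less[of "0::real"]
  proof eventually_elim
    case (elim r)
    then obtain u where "u \<in> ball x r" "K * r \<le> \<bar>f u - f x\<bar>"
      by blast
    then show ?case
      using elim by (intro SUP_upper2[of u] ennreal_leI) (auto simp: field_simps)
  qed
  then show "ennreal K \<le> little_lip f x"
    unfolding little_lip_def by (rule Liminf_bounded)
qed

lemma steep_at_imp_big_Lip: "steep_at f x \<Longrightarrow> big_Lip f x = \<infinity>"
proof (rule ennreal_eq_infinityI, rule ccontr)
  fix K :: real assume f: "steep_at f x" and K: "K > 0"
  assume "\<not> ennreal K \<le> big_Lip f x"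
  then have "eventually (\<lambda>u. ennreal (\<bar>f u - f x\<bar> / dist u x) < ennreal K) (at x)"
    unfolding big_Lip_def by (intro Limsup_lessD) auto
  then obtain e where "e > 0"
    and e: "\<And>u. u \<noteq> x \<Longrightarrow> dist u x < e \<Longrightarrow> ennreal (\<bar>f u - f x\<bar> / dist u x) < ennreal K"
    by (auto simp: eventually_at)
  obtain u where u: "u \<in> ball x e" "u \<noteq> x" "K \<le> \<bar>f u - f x\<bar> / dist u x"
    using steep_at_imp_secant[OF f K \<open>e > 0\<close>] .
  then have "ennreal K \<le> ennreal (\<bar>f u - f x\<bar> / dist u x)"
    by (intro ennreal_leI)
  moreover have "ennreal (\<bar>f u - f x\<bar> / dist u x) < ennreal K"
    using e[of u] u by (simp add: dist_commute)
  ultimately show False by (meson leD)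
qed

text \<open>The two-point quotient need not involve \<open>x\<close>, so steep secants based at
  nearby points of \<open>G\<close> suffice, even if \<open>x\<close> itself is outside
  \<open>G\<close>.\<close>

lemma steep_on_imp_local_Lip_closure:
  assumes f: "\<And>y. y \<in> G \<Longrightarrow> steep_at f y" and x: "x \<in> closure G"
  shows "local_Lip f x = \<infinity>"
proof (rule ennreal_eq_infinityI)
  fix K :: real assume K: "K > 0"
  show "ennreal K \<le> local_Lip f x"
    unfolding local_Lip_eq_INF_SUP
  proof (rule INF_greatest)
    fix r :: real assume "r \<in> {0<..}"
    then have r: "r > 0" by simp
    obtain y where y: "y \<in> G" "dist y x < r"
      using x r by (auto simp: closure_approachable)
    obtain u where u: "u \<in> ball y (r - dist y x)" "u \<noteq> y" "K \<le> \<bar>f u - f y\<bar> / dist u y"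
      \<comment> \<open>The radius \<open>r - dist y x\<close> keeps the secant inside
        \<open>ball x r\<close>.\<close>
      using steep_at_imp_secant[OF f[OF y(1)] K, of "r - dist y x"] y by auto
    have "dist x u < r"
      using dist_triangle[of x u y] u by (simp add: dist_commute)
    then show "ennreal K \<le> (SUP (u, v)\<in>{(u, v). u \<in> ball x r \<and> v \<in> ball x r \<and> u \<noteq> v}.
        ennreal (\<bar>f u - f v\<bar> / dist u v))"
      using u y by (intro SUP_upper2[of "(u, y)"]) (auto simp: dist_commute intro: ennreal_leI)
  qed
qed

section \<open>Finiteness of the derivatives away from the steep set\<close>

lemma pointwise_Lipschitz_imp_finite:
  assumes "\<And>u. \<bar>f u - f x\<bar> \<le> B * dist u x"
  shows "big_Lip f x < \<infinity>" "little_lip f x < \<infinity>"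
proof -
  have "eventually (\<lambda>u. ennreal (\<bar>f u - f x\<bar> / dist u x) \<le> ennreal B) (at x)"
    unfolding eventually_at_filter
    using assms by (intro always_eventually) (auto intro!: ennreal_leI simp: field_simps)
  then have "big_Lip f x \<le> ennreal B"
    unfolding big_Lip_def by (rule Limsup_bounded)
  then show "big_Lip f x < \<infinity>"
    by (simp add: le_less_trans)
  \<comment> \<open>The absolute value covers a negative \<open>B\<close>, possible if
    \<open>x\<close> is the only point.\<close>
  have "eventually (\<lambda>r. (SUP u\<in>ball x r. ennreal (1 / r * \<bar>f u - f x\<bar>)) \<le> ennreal \<bar>B\<bar>) (at_right 0)"
    using eventually_at_right_less[of "0::real"]
  proof eventually_elim
    case (elim r)
    show ?case
    proof (intro SUP_least ennreal_leI)
      fix u assume "u \<in> ball x r"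
      then have "\<bar>B\<bar> * dist u x \<le> \<bar>B\<bar> * r"
        by (intro mult_left_mono) (auto simp: dist_commute)
      moreover have "B * dist u x \<le> \<bar>B\<bar> * dist u x"
        by (intro mult_right_mono) auto
      ultimately have "\<bar>f u - f x\<bar> \<le> \<bar>B\<bar> * r"
        using assms[of u] by linarith
      then show "1 / r * \<bar>f u - f x\<bar> \<le> \<bar>B\<bar>"
        using elim by (simp add: field_simps)
    qed
  qed
  then have "Limsup (at_right 0) (\<lambda>r. SUP u\<in>ball x r. ennreal (1 / r * \<bar>f u - f x\<bar>)) \<le> ennreal \<bar>B\<bar>"
    by (rule Limsup_bounded)
  then have "little_lip f x \<le> ennreal \<bar>B\<bar>"
    unfolding little_lip_def
    by (rule order_trans[OF Liminf_le_Limsup[OF trivial_limit_at_right_real]])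
  then show "little_lip f x < \<infinity>"
    by (simp add: le_less_trans)
qed

lemma local_Lip_eq_0:
  assumes "open U" "x \<in> U" "\<And>u. u \<in> U \<Longrightarrow> f u = 0"
  shows "local_Lip f x = 0"
proof -
  obtain r where r: "r > 0" "ball x r \<subseteq> U"
    using assms openE by metis
  have "local_Lip f x \<le> (SUP (u, v)\<in>{(u, v). u \<in> ball x r \<and> v \<in> ball x r \<and> u \<noteq> v}.
      ennreal (\<bar>f u - f v\<bar> / dist u v))"
    unfolding local_Lip_eq_INF_SUP using r by (intro INF_lower) auto
  also have "\<dots> \<le> 0"
    using r assms by (intro SUP_least) (auto simp: subset_eq)
  finally show ?thesis by simp
qed

section \<open>Localisation to the open set\<close>

theorem theorem7p2:
  fixes G :: "'a::metric_space set"
  assumes "hermetic TYPE('a)"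
    and "open G"
    and "G \<subseteq> nonisolated_points"
  shows "\<exists>f :: 'a \<Rightarrow> real. continuous_on UNIV f
    \<and> big_Lip_infinity_set f = G
    \<and> little_lip_infinity_set f = G
    \<and> local_Lip_infinity_set f = closure G"
proof -
  obtain F :: "'a \<Rightarrow> real" where F: "continuous_on UNIV F" "\<And>x. \<bar>F x\<bar> \<le> 2"
    "\<And>x. x \<in> nonisolated_points \<Longrightarrow> steep_at F x"
    using hermetic_exists_steep_function[OF assms(1)] by metis
  \<comment> \<open>\<open>infdist\<close> to the empty set is \<open>0\<close>, so \<open>G = UNIV\<close> is treated separately.\<close>
  define \<rho> where "\<rho> u = (if G = UNIV then 1 else infdist u (- G))" for u
  have \<rho>_lip: "\<bar>\<rho> u - \<rho> x\<bar> \<le> dist u x" for u x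
    by (simp add: \<rho>_def infdist_triangle_abs)
  have \<rho>_pos: "\<rho> x > 0" if "x \<in> G" for x
    using that assms(2) infdist_pos_not_in_closed[of "- G" x]
    by (auto simp: \<rho>_def closed_def)
  have \<rho>_0: "\<rho> x = 0" if "x \<notin> G" for x
    using that by (auto simp: \<rho>_def)
  define f where "f u = \<rho> u * F u" for u
  have steep: "steep_at f x" if "x \<in> G" for x
    unfolding f_def using that assms(3) F \<rho>_lip \<rho>_pos
    by (intro steep_at_mult_Lipschitz[where B = 2]) auto
  \<comment> \<open>Since \<open>\<rho>\<close> vanishes at \<open>x\<close>, the product inherits a
    linear bound from \<open>\<rho>\<close> and the boundedness of \<open>F\<close>. This includes
    frontier points of \<open>G\<close>, where only the local Lipschitz derivative is
    infinite.\<close>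
  have flat: "\<bar>f u - f x\<bar> \<le> 2 * dist u x" if "x \<notin> G" for u x
  proof -
    have "\<bar>f u - f x\<bar> = \<bar>\<rho> u - \<rho> x\<bar> * \<bar>F u\<bar>"
      using \<rho>_0[OF that] by (simp add: f_def abs_mult)
    also have "\<dots> \<le> dist u x * 2"
      using \<rho>_lip F(2) by (intro mult_mono) auto
    finally show ?thesis by simp
  qed
  have "continuous_on UNIV \<rho>"
    by (cases "G = UNIV") (auto simp: \<rho>_def intro!: continuous_intros)
  then have "continuous_on UNIV f"
    unfolding f_def using F(1) by (intro continuous_intros)
  moreover have "big_Lip f x = \<infinity> \<longleftrightarrow> x \<in> G" "little_lip f x = \<infinity> \<longleftrightarrow> x \<in> G" for x
    using steep_at_imp_big_Lip[of f x] steep_at_imp_little_lip[of f x] steep[of x]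
      pointwise_Lipschitz_imp_finite[of f x 2] flat[of x] by (cases "x \<in> G"; simp)+
  then have "big_Lip_infinity_set f = G" "little_lip_infinity_set f = G"
    by (simp_all add: big_Lip_infinity_set_def little_lip_infinity_set_def)
  moreover have "local_Lip f x = \<infinity> \<longleftrightarrow> x \<in> closure G" for x
  proof (cases "x \<in> closure G")
    case True
    then show ?thesis
      using steep_on_imp_local_Lip_closure[OF steep] by simp
  next
    case False
    \<comment> \<open>The function vanishes on the open complement of
      \<open>closure G\<close>.\<close>
    have "local_Lip f x = 0"
      using False \<rho>_0 closure_subset[of G]
      by (intro local_Lip_eq_0[of "- closure G"]) (auto simp: f_def)
    then show ?thesis
      using False by simp
  qed
  then have "local_Lip_infinity_set f = closure G"
    by (simp add: local_Lip_infinity_set_def)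
  ultimately show ?thesis
    by (intro exI[of _ f] conjI)
qed

end
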